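(* For any basic sequence $(e_n)_n$ in a Banach space, there is a subsequence $(x_n)_n$ of $(e_n)_n$ satisfying one of the following properties: (i) for any subsequence $(y_n)_n$ of $(x_n)_n$ there is a sequence of successive intervals $(I_n)_n$ of $\mathbb{N}$ such that for every infinite $A\subseteq\mathbb{N}$, $(y_n)_n$ is permutatively equivalent to no subsequence of $(x_n)_n$ with indices in $\mathbb{N}\setminus\bigcup_{i\in A}I_i$; (ii) $(x_n)_n$ is spreading.
   Context: Two basic sequences $(x_n)_n,(y_n)_n$ are equivalent, $(x_n)_n\sim(y_n)_n$, if there is $K\ge1$ with $\frac1K\|\sum_{n\le k}a_nx_n\|\le\|\sum_{n\le k}a_ny_n\|\le K\|\sum_{n\le k}a_nx_n\|$ for all $k$ and all scalars $a_0,\dots,a_k$. They are permutatively equivalent if $(x_n)_n\sim(y_{\sigma(n)})_n$ for some permutation $\sigma$ of $\mathbb{N}$. A basic sequence is spreading if it is equivalent to all of its subsequences. Intervals are sets $[a,b]\cap\mathbb{N}$ with $0\le a<b$; a sequence of intervals is successive if $\max I_n<\min I_{n+1}$ for all $n$. *)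

theory Defs
  imports "HOL-Analysis.Analysis"
begin

text \<open>
  The scalar field is a variable so that real and complex Banach spaces are treated at once:
  by the Gelfand-Mazur theorem a complete \<open>real_normed_field\<close> is the field of real or of complex
  numbers. A complex Banach space is a type of class \<open>banach\<close> together with a complex scaling. No
  axiom connecting \<open>smul\<close> with \<open>scaleR\<close> is needed, since \<open>smul (of_real r) x = r *\<^sub>R x\<close> follows
  from additivity and continuity in \<open>r\<close>.
\<close>

locale banach_space_over = vector_space smul
  for smul :: "'k::{real_normed_field,banach} \<Rightarrow> 'a::banach \<Rightarrow> 'a" +
  assumes norm_scale: "norm (smul c x) = norm c * norm x"

lemma banach_space_over_real: "banach_space_over (scaleR :: real \<Rightarrow> 'a::banach \<Rightarrow> 'a)"
  by unfold_locales (simp_all add: algebra_simps)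

lemma banach_space_over_self:
  "banach_space_over ((*) :: 'k::{real_normed_field,banach} \<Rightarrow> 'k \<Rightarrow> 'k)"
  by unfold_locales (simp_all add: algebra_simps norm_mult)

text \<open>A basic sequence is a Schauder basis of its closed linear span.\<close>

definition basic_sequence ::
    "('k::{real_normed_field,banach} \<Rightarrow> 'a::banach \<Rightarrow> 'a) \<Rightarrow> (nat \<Rightarrow> 'a) \<Rightarrow> bool" where
  "basic_sequence smul e \<longleftrightarrow>
     (\<forall>v \<in> closure (module.span smul (range e)). \<exists>!a. (\<lambda>n. smul (a n) (e n)) sums v)"

definition is_subsequence :: "(nat \<Rightarrow> 'a) \<Rightarrow> (nat \<Rightarrow> 'a) \<Rightarrow> bool" where
  "is_subsequence y x \<longleftrightarrow> (\<exists>r. strict_mono r \<and> y = x \<circ> r)"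

definition is_subsequence_in :: "nat set \<Rightarrow> (nat \<Rightarrow> 'a) \<Rightarrow> (nat \<Rightarrow> 'a) \<Rightarrow> bool" where
  "is_subsequence_in D y x \<longleftrightarrow> (\<exists>r. strict_mono r \<and> range r \<subseteq> D \<and> y = x \<circ> r)"

text \<open>
  Basicness is not part of the two definitions below. It is inherited: a sequence for which
  the two-sided estimate against a basic sequence holds is itself basic. In particular this covers
  the rearrangement \<open>y \<circ> \<sigma>\<close>, which need not be basic for arbitrary \<open>\<sigma>\<close>.
\<close>

definition equivalent_seq ::
    "('k::{real_normed_field,banach} \<Rightarrow> 'a::banach \<Rightarrow> 'a) \<Rightarrow> (nat \<Rightarrow> 'a) \<Rightarrow> (nat \<Rightarrow> 'a) \<Rightarrow> bool" where
  "equivalent_seq smul x y \<longleftrightarrow>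
     (\<exists>K::real. K \<ge> 1 \<and> (\<forall>k. \<forall>a :: nat \<Rightarrow> 'k.
        1 / K * norm (\<Sum>n\<le>k. smul (a n) (x n)) \<le> norm (\<Sum>n\<le>k. smul (a n) (y n)) \<and>
        norm (\<Sum>n\<le>k. smul (a n) (y n)) \<le> K * norm (\<Sum>n\<le>k. smul (a n) (x n))))"

definition permutatively_equivalent ::
    "('k::{real_normed_field,banach} \<Rightarrow> 'a::banach \<Rightarrow> 'a) \<Rightarrow> (nat \<Rightarrow> 'a) \<Rightarrow> (nat \<Rightarrow> 'a) \<Rightarrow> bool" where
  "permutatively_equivalent smul x y \<longleftrightarrow> (\<exists>\<sigma>. bij \<sigma> \<and> equivalent_seq smul x (y \<circ> \<sigma>))"

definition spreading ::
    "('k::{real_normed_field,banach} \<Rightarrow> 'a::banach \<Rightarrow> 'a) \<Rightarrow> (nat \<Rightarrow> 'a) \<Rightarrow> bool" where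
  "spreading smul x \<longleftrightarrow>
     basic_sequence smul x \<and> (\<forall>y. is_subsequence y x \<longrightarrow> equivalent_seq smul x y)"

definition nat_interval :: "nat set \<Rightarrow> bool" where
  "nat_interval J \<longleftrightarrow> (\<exists>a b. a < b \<and> J = {a..b})"

definition successive_intervals :: "(nat \<Rightarrow> nat set) \<Rightarrow> bool" where
  "successive_intervals I \<longleftrightarrow>
     (\<forall>n. nat_interval (I n)) \<and> (\<forall>n. Max (I n) < Min (I (Suc n)))"

end

theory Submission
  imports Defs "HOL-Library.Ramsey" "HOL-Library.Diagonal_Subsequence"
begin

text \<open>
  Fix a subsequence \<open>x\<close> and a subsequence \<open>y\<close> of \<open>x\<close>. If \<open>y\<close> is permutatively equivalent to a
  subsequence of \<open>x\<close> with index gap \<open>{m..M}\<close>, then fewer than \<open>m + 1\<close> of the terms \<open>y\<^sub>0, \<dots>, y\<^sub>M\<close> are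
  sent below the gap, and the others are copied beyond \<open>M\<close>. So (i) can fail only if, for some \<open>m\<close>
  and \<open>K\<close>, such \<open>K\<close>-copies exist for all \<open>M > m\<close>. Ramsey's theorem for triples then gives a
  subsequence of \<open>y\<close> all of whose finite pieces have \<open>K\<close>-copies arbitrarily far out in \<open>x\<close>, either
  always in the same order or always in the reversed order.

  By Ramsey's theorem for \<open>2k\<close>-sets and diagonalization, \<open>x\<close> can be chosen in one of two ways. In
  the first, for every \<open>C\<close> there is a \<open>k\<close> such that no two successive \<open>k\<close>-tuples far out in \<open>x\<close> are
  \<open>C\<close>-equivalent; the copies contradict this for \<open>C \<ge> K\<^sup>2\<close>, so (i) holds. In the second there is one
  \<open>C\<close> such that for every \<open>k\<close> all successive \<open>k\<close>-tuples far out are \<open>C\<close>-equivalent; if (i) fails,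
  the comparison of two copies shows that the extracted subsequence of \<open>y\<close> is
  \<open>K\<^sup>2C\<close>-equivalent to all of its subsequences. A reversal of the order does no harm, since both
  copies are reversed.
\<close>

section \<open>Ramsey's theorem for increasing tuples\<close>

text \<open>Colour an \<open>n\<close>-set by the truth of \<open>Q\<close> on its increasing
  enumeration and let \<open>r\<close> enumerate a homogeneous set. By \<open>local\<close>, the
  arbitrary values of the enumeration from index \<open>n\<close> on do not affect the
  colour.\<close>

lemma Ramsey_tuples:
  fixes Q :: "(nat \<Rightarrow> nat) \<Rightarrow> bool"
  assumes local: "\<And>p q. (\<And>i. i < n \<Longrightarrow> p i = q i) \<Longrightarrow> Q p = Q q"
  obtains r :: "nat \<Rightarrow> nat" and b where "strict_mono r"
    "\<And>p. strict_mono_on {..<n} p \<Longrightarrow> Q (r \<circ> p) = b"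
proof -
  define f :: "nat set \<Rightarrow> nat" where
    "f X = (if Q (\<lambda>i. sorted_list_of_set X ! i) then 0 else 1)" for X
  have "\<exists>Y t. Y \<subseteq> UNIV \<and> infinite Y \<and> t < 2 \<and> (\<forall>X. X \<subseteq> Y \<and> finite X \<and> card X = n \<longrightarrow> f X = t)"
    by (rule Ramsey) (auto simp: f_def)
  then obtain Y t where Y: "infinite Y" "\<And>X. X \<subseteq> Y \<Longrightarrow> finite X \<Longrightarrow> card X = n \<Longrightarrow> f X = t"
    by auto
  define r where "r = enumerate Y"
  have r: "strict_mono r"
    using Y(1) by (simp add: r_def strict_mono_enumerate)
  have "Q (r \<circ> p) = (t = 0)" if p: "strict_mono_on {..<n} p" for p
  proof -
    let ?g = "r \<circ> p"
    have g: "strict_mono_on {..<n} ?g"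
      using r p by (auto simp: strict_mono_on_def strict_mono_def)
    have inj: "inj_on ?g {..<n}"
      by (rule strict_mono_on_imp_inj_on[OF g])
    have sorted: "sorted (map ?g [0..<n])"
      using g by (auto simp: sorted_iff_nth_mono_less strict_mono_on_def less_imp_le)
    have "sorted_list_of_set (set (map ?g [0..<n])) = map ?g [0..<n]"
      by (rule sorted_list_of_set.idem_if_sorted_distinct[OF sorted])
        (use inj in \<open>simp add: distinct_map atLeast0LessThan\<close>)
    then have l: "sorted_list_of_set (?g ` {..<n}) = map ?g [0..<n]"
      by (simp add: atLeast0LessThan)
    have "?g ` {..<n} \<subseteq> Y"
      using enumerate_in_set[OF Y(1)] by (auto simp: r_def)
    then have "f (?g ` {..<n}) = t"
      using card_image[OF inj] by (intro Y(2)) simp_all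
    moreover have "Q (\<lambda>i. sorted_list_of_set (?g ` {..<n}) ! i) = Q ?g"
      by (rule local) (subst l, simp)
    ultimately show ?thesis
      by (auto simp: f_def split: if_splits)
  qed
  with r show ?thesis by (rule that)
qed

lemma Ramsey_triples:
  fixes R :: "nat \<Rightarrow> nat \<Rightarrow> nat \<Rightarrow> bool"
  obtains r :: "nat \<Rightarrow> nat" and b where "strict_mono r"
    "\<And>i j k. i < j \<Longrightarrow> j < k \<Longrightarrow> R (r i) (r j) (r k) = b"
proof -
  obtain r :: "nat \<Rightarrow> nat" and b where r: "strict_mono r"
    "\<And>p :: nat \<Rightarrow> nat. strict_mono_on {..<3} p \<Longrightarrow> R ((r \<circ> p) 0) ((r \<circ> p) 1) ((r \<circ> p) 2) = b"
    by (rule Ramsey_tuples[of 3 "\<lambda>p. R (p 0) (p 1) (p 2)"]) auto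
  have "R (r i) (r j) (r k) = b" if "i < j" "j < k" for i j k
  proof -
    define p :: "nat \<Rightarrow> nat" where "p = (\<lambda>n. if n = 0 then i else if n = 1 then j else k)"
    have "strict_mono_on {..<3} p"
      using that by (auto simp: strict_mono_on_def p_def)
    from r(2)[OF this] show ?thesis by (simp add: p_def)
  qed
  with r(1) show ?thesis by (rule that)
qed

section \<open>Equivalence of finite families\<close>

text \<open>General index sets are allowed because copies live on initial segments with finitely
  many holes. Multiplying by \<open>K\<close> in both estimates makes the relation symmetric for
  every real \<open>K\<close>.\<close>

definition equiv_on ::
    "('k::{real_normed_field,banach} \<Rightarrow> 'a::banach \<Rightarrow> 'a) \<Rightarrow> real \<Rightarrow> nat set \<Rightarrow> (nat \<Rightarrow> 'a) \<Rightarrow> (nat \<Rightarrow> 'a) \<Rightarrow> bool" where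
  "equiv_on smul K S u v \<longleftrightarrow>
     (\<forall>a :: nat \<Rightarrow> 'k.
        norm (\<Sum>n\<in>S. smul (a n) (u n)) \<le> K * norm (\<Sum>n\<in>S. smul (a n) (v n)) \<and>
        norm (\<Sum>n\<in>S. smul (a n) (v n)) \<le> K * norm (\<Sum>n\<in>S. smul (a n) (u n)))"

lemma equiv_on_sym: "equiv_on smul K S u v \<Longrightarrow> equiv_on smul K S v u"
  by (auto simp: equiv_on_def)

lemma equiv_on_trans:
  assumes "equiv_on smul K S u v" "equiv_on smul L S v w" "0 \<le> K" "0 \<le> L"
  shows "equiv_on smul (K * L) S u w"
  unfolding equiv_on_def
proof (intro allI conjI)
  fix a
  let ?N = "\<lambda>u. norm (\<Sum>n\<in>S. smul (a n) (u n))"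
  have "?N u \<le> K * ?N v" "?N v \<le> L * ?N w" "?N w \<le> L * ?N v" "?N v \<le> K * ?N u"
    using assms(1,2) by (auto simp: equiv_on_def)
  then show "?N u \<le> K * L * ?N w" "?N w \<le> K * L * ?N u"
    using mult_left_mono[of "?N v" "L * ?N w" K] mult_left_mono[of "?N v" "K * ?N u" L] assms(3,4)
    by (auto simp: mult_ac)
qed

lemma equiv_on_mono:
  assumes "equiv_on smul K S u v" "K \<le> L"
  shows "equiv_on smul L S u v"
  using assms unfolding equiv_on_def
  by (meson mult_right_mono norm_ge_zero order_trans)

lemma equivalent_seq_iff_equiv_on:
  "equivalent_seq smul x y \<longleftrightarrow> (\<exists>K\<ge>1. \<forall>k. equiv_on smul K {..k} x y)"
  unfolding equivalent_seq_def equiv_on_def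
  by (intro ex_cong1 conj_cong refl) (auto simp: field_simps)

context banach_space_over
begin

text \<open>The coefficients are moved along \<open>h\<close> and extended by zero to
  \<open>T\<close>, which turns each sum over \<open>S\<close> into one over \<open>T\<close>. The
  identity as \<open>h\<close> gives restriction, a permutation gives reordering.\<close>

lemma equiv_on_reindex:
  assumes uv: "equiv_on smul K T u v" and inj: "inj_on h S" and sub: "h ` S \<subseteq> T" and fin: "finite T"
  shows "equiv_on smul K S (u \<circ> h) (v \<circ> h)"
  unfolding equiv_on_def
proof
  fix a :: "nat \<Rightarrow> 'k"
  define b where "b n = (if n \<in> h ` S then a (inv_into S h n) else 0)" for n
  have eq: "(\<Sum>n\<in>T. smul (b n) (w n)) = (\<Sum>n\<in>S. smul (a n) ((w \<circ> h) n))" for w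
  proof -
    have "(\<Sum>n\<in>T. smul (b n) (w n)) = (\<Sum>n\<in>h ` S. smul (b n) (w n))"
      by (rule sum.mono_neutral_right) (auto simp: fin sub b_def)
    also have "\<dots> = (\<Sum>n\<in>S. smul (b (h n)) (w (h n)))"
      by (simp add: sum.reindex[OF inj])
    also have "\<dots> = (\<Sum>n\<in>S. smul (a n) ((w \<circ> h) n))"
      by (rule sum.cong) (auto simp: b_def inv_into_f_f[OF inj])
    finally show ?thesis .
  qed
  show "norm (\<Sum>n\<in>S. smul (a n) ((u \<circ> h) n)) \<le> K * norm (\<Sum>n\<in>S. smul (a n) ((v \<circ> h) n)) \<and>
        norm (\<Sum>n\<in>S. smul (a n) ((v \<circ> h) n)) \<le> K * norm (\<Sum>n\<in>S. smul (a n) ((u \<circ> h) n))"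
    using uv unfolding equiv_on_def eq[symmetric] by blast
qed

lemma equiv_on_subset:
  assumes "equiv_on smul K T u v" "S \<subseteq> T" "finite T"
  shows "equiv_on smul K S u v"
  using equiv_on_reindex[OF assms(1), of id S] assms by (simp add: comp_def)

end

section \<open>Copies beyond a gap\<close>

text \<open>\<open>F\<close> holds the terms of \<open>y\<close> that may be lost below a gap
  \<open>{m..M}\<close>, hence the bound \<open>m\<close>; the remaining terms have to jump over the
  gap, hence \<open>M < \<tau> n\<close>.\<close>

definition tail_copy ::
    "('k::{real_normed_field,banach} \<Rightarrow> 'a::banach \<Rightarrow> 'a) \<Rightarrow> (nat \<Rightarrow> 'a) \<Rightarrow> (nat \<Rightarrow> 'a) \<Rightarrow> nat \<Rightarrow> real \<Rightarrow> nat \<Rightarrow> bool" where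
  "tail_copy smul x y m K M \<longleftrightarrow>
     (\<exists>F \<tau>. finite F \<and> card F \<le> m \<and> inj_on \<tau> ({..M} - F) \<and> (\<forall>n\<in>{..M} - F. M < \<tau> n) \<and>
        equiv_on smul K ({..M} - F) y (x \<circ> \<tau>))"

text \<open>Here \<open>m\<close> is the left end of a prospective interval and \<open>M\<close> its
  right end. As all \<open>m\<close> and \<open>K\<close> are covered, intervals can be chosen one
  after another with growing constants.\<close>

definition gap_tight ::
    "('k::{real_normed_field,banach} \<Rightarrow> 'a::banach \<Rightarrow> 'a) \<Rightarrow> (nat \<Rightarrow> 'a) \<Rightarrow> bool" where
  "gap_tight smul x \<longleftrightarrow> (\<forall>y m K. is_subsequence y x \<longrightarrow> (\<exists>M>m. \<not> tail_copy smul x y m K M))"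

context banach_space_over
begin

text \<open>\<open>I i\<close> starts at \<open>c i\<close> and ends where tightness excludes copies
  with constant \<open>i + 1\<close>. An equivalence with constant \<open>K\<close> that avoids
  \<open>I i\<close> for some \<open>i \<in> A\<close> with \<open>K \<le> i\<close> would produce
  such a copy; an infinite \<open>A\<close> contains such an \<open>i\<close>.\<close>

lemma gap_tight_imp_intervals:
  assumes "gap_tight smul x" and y: "is_subsequence y x"
  shows "\<exists>I. successive_intervals I \<and>
          (\<forall>A :: nat set. infinite A \<longrightarrow>
            \<not> (\<exists>z. is_subsequence_in (UNIV - (\<Union>i\<in>A. I i)) z x \<and>
                  permutatively_equivalent smul y z))"
proof -
  have "\<forall>m i. \<exists>M>m. \<not> tail_copy smul x y m (real (Suc i)) M"
    using assms by (auto simp: gap_tight_def)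
  then obtain g where g: "\<And>m i. m < g m i" "\<And>m i. \<not> tail_copy smul x y m (real (Suc i)) (g m i)"
    by metis
  define c where "c = rec_nat 0 (\<lambda>i m. Suc (g m i))"
  define I where "I i = {c i..g (c i) i}" for i
  have c: "c (Suc i) = Suc (g (c i) i)" for i
    by (simp add: c_def)
  have le: "c i \<le> g (c i) i" for i
    using g(1) less_imp_le by blast
  have "successive_intervals I"
    unfolding successive_intervals_def nat_interval_def I_def
  proof (intro conjI allI)
    fix n
    show "\<exists>a b. a < b \<and> {c n..g (c n) n} = {a..b}"
      using g(1) by blast
    have "Max {c n..g (c n) n} \<le> g (c n) n"
      using le by (subst Max_le_iff) auto
    moreover have "c (Suc n) \<le> Min {c (Suc n)..g (c (Suc n)) (Suc n)}"
      using le by (subst Min_ge_iff) auto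
    ultimately show "Max {c n..g (c n) n} < Min {c (Suc n)..g (c (Suc n)) (Suc n)}"
      using c[of n] by simp
  qed
  moreover have False
    if A: "infinite A" and z: "is_subsequence_in (UNIV - (\<Union>i\<in>A. I i)) z x"
      and p: "permutatively_equivalent smul y z" for A z
  proof -
    obtain r where r: "strict_mono r" "range r \<subseteq> UNIV - (\<Union>i\<in>A. I i)" "z = x \<circ> r"
      using z by (auto simp: is_subsequence_in_def)
    obtain \<sigma> K where s: "bij \<sigma>" and K: "\<And>k. equiv_on smul K {..k} y (z \<circ> \<sigma>)"
      using p by (auto simp: permutatively_equivalent_def equivalent_seq_iff_equiv_on)
    obtain i where i: "i \<in> A" "nat \<lceil>K\<rceil> \<le> i"
      using A infinite_nat_iff_unbounded_le by blast
    define \<tau> where "\<tau> = r \<circ> \<sigma>"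
    let ?M = "g (c i) i"
    \<comment> \<open>By injectivity of \<open>\<tau>\<close> at most \<open>c i\<close> terms land
      below \<open>c i\<close>; every other term avoids \<open>I i\<close> and so lands beyond
      \<open>?M\<close>.\<close>
    define F where "F = {n. \<tau> n < c i}"
    have inj: "inj \<tau>"
      unfolding \<tau>_def using s r(1) by (simp add: bij_def inj_compose strict_mono_imp_inj_on)
    have img: "\<tau> ` F \<subseteq> {..<c i}"
      by (auto simp: F_def)
    have finF: "finite F"
      using inj img by (meson finite_lessThan finite_subset inj_on_finite inj_on_subset subset_UNIV)
    moreover have "card F \<le> c i"
      using card_inj_on_le[OF inj_on_subset[OF inj subset_UNIV] img] by simp
    moreover have "inj_on \<tau> ({..?M} - F)"
      using inj by (rule inj_on_subset) simp
    moreover have "?M < \<tau> n" if "n \<in> {..?M} - F" for n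
    proof -
      have "\<tau> n \<notin> I i"
        using r(2) i(1) by (auto simp: \<tau>_def)
      with that show ?thesis by (auto simp: I_def F_def)
    qed
    moreover have "equiv_on smul (real (Suc i)) ({..?M} - F) y (x \<circ> \<tau>)"
    proof (rule equiv_on_subset[where T = "{..?M}"])
      have "K \<le> real (Suc i)"
        using i(2) by linarith
      with K[of ?M] show "equiv_on smul (real (Suc i)) {..?M} y (x \<circ> \<tau>)"
        by (simp add: r(3) \<tau>_def comp_assoc equiv_on_mono)
    qed auto
    ultimately have "tail_copy smul x y (c i) (real (Suc i)) ?M"
      unfolding tail_copy_def by blast
    with g(2) show False by blast
  qed
  ultimately show ?thesis by blast
qed

text \<open>In the last clause \<open>\<rho>\<close> is the identity or the reversal of \<open>{..<k}\<close>, the same for all \<open>M\<close>.\<close>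

lemma tail_copies_ordered:
  assumes tc: "\<And>M. m < M \<Longrightarrow> tail_copy smul x y m K M"
  shows "\<exists>h \<tau>. strict_mono (h :: nat \<Rightarrow> nat) \<and>
    (\<forall>M. \<forall>i<M. M \<le> \<tau> M i) \<and>
    (\<forall>M. equiv_on smul K {..<M} (y \<circ> h) (x \<circ> \<tau> M)) \<and>
    (\<forall>k :: nat. \<exists>\<rho>. bij_betw \<rho> {..<k} {..<k} \<and>
       (\<forall>M p. strict_mono_on {..<k} p \<longrightarrow> (\<forall>i<k. p i < M) \<longrightarrow> strict_mono_on {..<k} (\<tau> M \<circ> p \<circ> \<rho>)))"
proof -
  obtain F T where FT: "\<And>M. m < M \<Longrightarrow> finite (F M) \<and> card (F M) \<le> m \<and> inj_on (T M) ({..M} - F M) \<and>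
       (\<forall>n\<in>{..M} - F M. M < T M n) \<and> equiv_on smul K ({..M} - F M) y (x \<circ> T M)"
    using tc unfolding tail_copy_def by metis
  \<comment> \<open>Colour a triple by whether its first two entries both escape the exceptional set
    of the third. On a homogeneous set with positive colour the copies have no holes.\<close>
  obtain r1 :: "nat \<Rightarrow> nat" and b1 where r1: "strict_mono r1"
    and b1: "\<And>i j k. i < j \<Longrightarrow> j < k \<Longrightarrow> (r1 i \<notin> F (r1 k) \<and> r1 j \<notin> F (r1 k)) = b1"
    using Ramsey_triples[of "\<lambda>i j k. i \<notin> F k \<and> j \<notin> F k"] by blast
  \<comment> \<open>The third entry of a triple names the copy, so homogeneity gives all copies the
    same order behaviour.\<close>
  obtain r2 :: "nat \<Rightarrow> nat" and b2 where r2: "strict_mono r2"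
    and b2: "\<And>i j k. i < j \<Longrightarrow> j < k \<Longrightarrow>
      (T (r1 (r2 k)) (r1 (r2 i)) < T (r1 (r2 k)) (r1 (r2 j))) = b2"
    using Ramsey_triples[of "\<lambda>i j k. T (r1 k) (r1 i) < T (r1 k) (r1 j)"] by blast
  have b1: "r1 i \<notin> F (r1 k) \<and> r1 j \<notin> F (r1 k)" if "i < j" "j < k" for i j k
  proof -
    have b1
    proof (rule ccontr)
      assume "\<not> b1"
      \<comment> \<open>With negative colour at most one of the \<open>m + 2\<close> indices
        \<open>r1 0, ..., r1 (m + 1)\<close> avoids \<open>F (r1 N)\<close>, which would force
        \<open>m + 1\<close> elements into a set of size at most \<open>m\<close>.\<close>
      define N where "N = m + 2"
      define G where "G = {i. i < N \<and> r1 i \<notin> F (r1 N)}"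
      have "i = j" if "i \<in> G" "j \<in> G" for i j
        using b1[of i j N] b1[of j i N] \<open>\<not> b1\<close> that by (cases i j rule: linorder_cases) (auto simp: G_def)
      then have cG: "card G \<le> 1"
        by (metis card_le_Suc0_iff_eq One_nat_def card.infinite zero_le)
      have "m < r1 N"
        using strict_mono_imp_increasing[OF r1, of N] by (simp add: N_def)
      then have fF: "finite (F (r1 N))" "card (F (r1 N)) \<le> m"
        using FT by auto
      have "r1 ` ({..<N} - G) \<subseteq> F (r1 N)"
        by (auto simp: G_def)
      then have "card ({..<N} - G) \<le> m"
        using card_inj_on_le[of r1 "{..<N} - G" "F (r1 N)"] fF strict_mono_imp_inj_on[OF r1]
        by (meson inj_on_subset order_trans subset_UNIV)
      moreover have "N - card G \<le> card ({..<N} - G)"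
        using diff_card_le_card_Diff[of G "{..<N}"] by (simp add: G_def)
      ultimately show False
        using cG by (simp add: N_def)
    qed
    with b1[OF that] show ?thesis by simp
  qed
  define h where "h = r1 \<circ> r2"
  \<comment> \<open>The shift puts \<open>h (s M)\<close> above both \<open>m\<close> and
    \<open>M\<close>, and leaves room for a middle index between any \<open>i < M\<close> and
    \<open>s M\<close>, so that the colour of triples applies.\<close>
  define s where "s M = M + m + 2" for M
  define \<tau> where "\<tau> M = T (h (s M)) \<circ> h" for M
  have h: "strict_mono h"
    unfolding h_def using r1 r2 by (simp add: strict_mono_o)
  have hs: "m < h (s M)" "M < h (s M)" for M
    using strict_mono_imp_increasing[OF h, of "s M"] by (auto simp: s_def)
  have mem: "h i \<in> {..h (s M)} - F (h (s M))" if "i < M" for i M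
  proof -
    have "r2 i < r2 (Suc i)" "r2 (Suc i) < r2 (s M)"
      using that by (auto intro!: strict_monoD[OF r2] simp: s_def)
    then show ?thesis
      using b1[of "r2 i" "r2 (Suc i)" "r2 (s M)"] strict_mono_less_eq[OF h, of i "s M"] that
      by (auto simp: h_def s_def)
  qed
  have t1: "M \<le> \<tau> M i" if "i < M" for M i
    using FT[OF hs(1)[of M]] mem[OF that] hs(2)[of M] unfolding \<tau>_def
    by (metis comp_apply dual_order.strict_trans less_imp_le)
  have t2: "equiv_on smul K {..<M} (y \<circ> h) (x \<circ> \<tau> M)" for M
  proof -
    have "equiv_on smul K {..<M} (y \<circ> h) ((x \<circ> T (h (s M))) \<circ> h)"
      by (rule equiv_on_reindex[where T = "{..h (s M)} - F (h (s M))"])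
        (use FT[OF hs(1)] mem strict_mono_imp_inj_on[OF h] in \<open>auto intro: inj_on_subset\<close>)
    then show ?thesis by (simp add: \<tau>_def comp_assoc)
  qed
  have inj: "inj_on (\<tau> M) {..<M}" for M
    unfolding \<tau>_def
    using FT[OF hs(1)[of M]] mem[of _ M] strict_mono_imp_inj_on[OF h]
    by (intro comp_inj_on) (auto intro: inj_on_subset)
  have ord: "(\<tau> M i < \<tau> M j) = b2" if "i < j" "j < M" for i j M
    using b2[of i j "s M"] that by (simp add: \<tau>_def h_def s_def)
  have t3: "\<exists>\<rho>. bij_betw \<rho> {..<k} {..<k} \<and>
       (\<forall>M p. strict_mono_on {..<k} p \<longrightarrow> (\<forall>i<k. p i < M) \<longrightarrow> strict_mono_on {..<k} (\<tau> M \<circ> p \<circ> \<rho>))" for k :: nat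
  proof (cases b2)
    case True
    then have "strict_mono_on {..<k} (\<tau> M \<circ> p \<circ> id)"
      if "strict_mono_on {..<k} p" "\<forall>i<k. p i < M" for M p
      using that ord unfolding strict_mono_on_def by auto
    then show ?thesis by (intro exI[of _ id]) auto
  next
    case False
    \<comment> \<open>Now every \<open>\<tau> M\<close> is strictly decreasing on
      \<open>{..<M}\<close>, by injectivity; reversing the tuple makes its image increasing.\<close>
    define \<rho> where "\<rho> i = k - Suc i" for i
    have "bij_betw \<rho> {..<k} {..<k}"
      by (rule bij_betw_byWitness[where f' = \<rho>]) (auto simp: \<rho>_def)
    moreover have "strict_mono_on {..<k} (\<tau> M \<circ> p \<circ> \<rho>)"
      if p: "strict_mono_on {..<k} p" "\<forall>i<k. p i < M" for M p
      unfolding strict_mono_on_def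
    proof (intro allI impI)
      fix i j assume ij: "i \<in> {..<k} \<and> j \<in> {..<k} \<and> i < j"
      then have lt: "p (\<rho> j) < p (\<rho> i)" and M: "p (\<rho> i) < M"
        using p by (auto simp: strict_mono_on_def \<rho>_def)
      then have "\<tau> M (p (\<rho> j)) \<noteq> \<tau> M (p (\<rho> i))"
        using inj[of M] by (auto dest: inj_onD)
      with ord[OF lt M] False show "(\<tau> M \<circ> p \<circ> \<rho>) i < (\<tau> M \<circ> p \<circ> \<rho>) j"
        by auto
    qed
    ultimately show ?thesis by blast
  qed
  show ?thesis
    using h t1 t2 t3 by blast
qed

end

section \<open>Uniform and separated sequences\<close>

definition successive_tuples :: "nat \<Rightarrow> nat \<Rightarrow> (nat \<Rightarrow> nat) \<Rightarrow> (nat \<Rightarrow> nat) \<Rightarrow> bool" where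
  "successive_tuples k N p q \<longleftrightarrow> strict_mono_on {..<k} p \<and> strict_mono_on {..<k} q \<and>
     (\<forall>i<k. N \<le> p i) \<and> (\<forall>i<k. \<forall>j<k. p i < q j)"

text \<open>The threshold \<open>N\<close> serves the diagonalization: a diagonal sequence is a
  subsequence of each sequence of the construction only from some index on.\<close>

definition uniform ::
    "('k::{real_normed_field,banach} \<Rightarrow> 'a::banach \<Rightarrow> 'a) \<Rightarrow> real \<Rightarrow> nat \<Rightarrow> nat \<Rightarrow> (nat \<Rightarrow> 'a) \<Rightarrow> bool" where
  "uniform smul C k N x \<longleftrightarrow>
     (\<forall>p q. successive_tuples k N p q \<longrightarrow> equiv_on smul C {..<k} (x \<circ> p) (x \<circ> q))"

definition separated ::
    "('k::{real_normed_field,banach} \<Rightarrow> 'a::banach \<Rightarrow> 'a) \<Rightarrow> real \<Rightarrow> nat \<Rightarrow> nat \<Rightarrow> (nat \<Rightarrow> 'a) \<Rightarrow> bool" where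
  "separated smul C k N x \<longleftrightarrow>
     (\<forall>p q. successive_tuples k N p q \<longrightarrow> \<not> equiv_on smul C {..<k} (x \<circ> p) (x \<circ> q))"

section \<open>Passing to subsequences and tails\<close>

lemma successive_tuples_compose:
  assumes "strict_mono r" "successive_tuples k N p q"
  shows "successive_tuples k 0 (r \<circ> p) (r \<circ> q)"
  using assms by (auto simp: successive_tuples_def strict_mono_on_def strict_mono_def)

text \<open>All entries of both tuples are at least \<open>N\<close>, so truncated subtraction
  preserves the strict inequalities.\<close>

lemma successive_tuples_shift:
  assumes "successive_tuples k N p q"
  shows "successive_tuples k 0 (\<lambda>i. p i - N) (\<lambda>i. q i - N)"
  unfolding successive_tuples_def strict_mono_on_def
proof (intro conjI allI impI)
  fix i j assume "i < k" "j < k"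
  with assms have "p i < q j" "N \<le> p i" by (auto simp: successive_tuples_def)
  then show "p i - N < q j - N" by linarith
next
  fix i j assume ij: "i \<in> {..<k} \<and> j \<in> {..<k} \<and> i < j"
  with assms have *: "p i < p j" "q i < q j" "N \<le> p i" "p i < q i"
    by (auto simp: successive_tuples_def strict_mono_on_def)
  from * show "p i - N < p j - N" by linarith
  from * show "q i - N < q j - N" by linarith
qed auto

lemma uniform_subseq:
  assumes "uniform smul C k 0 (x \<circ> s)" "strict_mono r"
  shows "uniform smul C k 0 (x \<circ> (s \<circ> r))"
  using assms successive_tuples_compose[OF assms(2)] by (auto simp: uniform_def comp_assoc)

lemma separated_subseq:
  assumes "separated smul C k 0 (x \<circ> s)" "strict_mono r"
  shows "separated smul C k 0 (x \<circ> (s \<circ> r))"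
  using assms successive_tuples_compose[OF assms(2)] by (auto simp: separated_def comp_assoc)

context banach_space_over
begin

lemma equiv_on_cong:
  assumes "\<And>n. n \<in> S \<Longrightarrow> u n = u' n" "\<And>n. n \<in> S \<Longrightarrow> v n = v' n"
  shows "equiv_on smul K S u v = equiv_on smul K S u' v'"
  unfolding equiv_on_def using assms by simp

lemma uniform_shift:
  assumes "uniform smul C k 0 (x \<circ> (+) N)"
  shows "uniform smul C k N x"
  unfolding uniform_def
proof (intro allI impI)
  fix p q assume pq: "successive_tuples k N p q"
  have "equiv_on smul C {..<k} (x \<circ> (+) N \<circ> (\<lambda>i. p i - N)) (x \<circ> (+) N \<circ> (\<lambda>i. q i - N))"
    using assms successive_tuples_shift[OF pq] by (auto simp: uniform_def)
  also have "?this \<longleftrightarrow> equiv_on smul C {..<k} (x \<circ> p) (x \<circ> q)"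
    by (rule equiv_on_cong) (use pq in \<open>force simp: successive_tuples_def\<close>)+
  finally show "equiv_on smul C {..<k} (x \<circ> p) (x \<circ> q)" .
qed

lemma separated_shift:
  assumes "separated smul C k 0 (x \<circ> (+) N)"
  shows "separated smul C k N x"
  unfolding separated_def
proof (intro allI impI)
  fix p q assume pq: "successive_tuples k N p q"
  have "\<not> equiv_on smul C {..<k} (x \<circ> (+) N \<circ> (\<lambda>i. p i - N)) (x \<circ> (+) N \<circ> (\<lambda>i. q i - N))"
    using assms successive_tuples_shift[OF pq] by (auto simp: separated_def)
  also have "equiv_on smul C {..<k} (x \<circ> (+) N \<circ> (\<lambda>i. p i - N)) (x \<circ> (+) N \<circ> (\<lambda>i. q i - N)) =
      equiv_on smul C {..<k} (x \<circ> p) (x \<circ> q)"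
    by (rule equiv_on_cong) (use pq in \<open>force simp: successive_tuples_def\<close>)+
  finally show "\<not> equiv_on smul C {..<k} (x \<circ> p) (x \<circ> q)" .
qed

text \<open>An increasing \<open>2 * k\<close>-tuple is a pair of successive
  \<open>k\<close>-tuples; colour it by whether its halves are \<open>C\<close>-equivalent.\<close>

lemma uniform_or_separated:
  obtains r :: "nat \<Rightarrow> nat" where "strict_mono r" "uniform smul C k 0 (x \<circ> r) \<or> separated smul C k 0 (x \<circ> r)"
proof -
  let ?Q = "\<lambda>p. equiv_on smul C {..<k} (x \<circ> p) (x \<circ> (\<lambda>i. p (k + i)))"
  obtain r :: "nat \<Rightarrow> nat" and b where r: "strict_mono r"
    "\<And>p. strict_mono_on {..<2 * k} p \<Longrightarrow> ?Q (r \<circ> p) = b"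
  proof (rule Ramsey_tuples[of "2 * k" ?Q])
    show "?Q p = ?Q q" if "\<And>i. i < 2 * k \<Longrightarrow> p i = q i" for p q
      by (rule equiv_on_cong) (use that in auto)
  qed blast
  have "equiv_on smul C {..<k} (x \<circ> r \<circ> p) (x \<circ> r \<circ> q) = b" if pq: "successive_tuples k 0 p q" for p q
  proof -
    define w where "w i = (if i < k then p i else q (i - k))" for i
    have "strict_mono_on {..<2 * k} w"
      unfolding strict_mono_on_def
    proof (intro allI impI)
      fix i j assume ij: "i \<in> {..<2 * k} \<and> j \<in> {..<2 * k} \<and> i < j"
      show "w i < w j"
      proof (cases "i < k \<and> \<not> j < k")
        case True
        then have "i < k" "j - k < k" using ij by auto
        with True pq show ?thesis by (auto simp: w_def successive_tuples_def)
      next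
        case False
        then have "j < k \<or> (k \<le> i \<and> i - k < j - k \<and> j - k < k)" using ij by auto
        with ij pq show ?thesis by (auto simp: w_def successive_tuples_def strict_mono_on_def)
      qed
    qed
    from r(2)[OF this] have "?Q (r \<circ> w) = b" .
    also have "?Q (r \<circ> w) = equiv_on smul C {..<k} (x \<circ> r \<circ> p) (x \<circ> r \<circ> q)"
      by (rule equiv_on_cong) (auto simp: w_def)
    finally show ?thesis .
  qed
  then have "uniform smul C k 0 (x \<circ> r) \<or> separated smul C k 0 (x \<circ> r)"
    by (cases b) (auto simp: uniform_def separated_def)
  with r(1) show ?thesis by (rule that)
qed

text \<open>The question is whether, for one constant and below one subsequence, every further
  subsequence can be refined to a uniform one, for each \<open>k\<close>. If so, diagonalize over
  \<open>k\<close> with this constant. If not, each constant has a \<open>k\<close> for which, below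
  any given subsequence, some subsequence has no uniform refinement; there the Ramsey alternative
  must be separation, and one diagonalizes over the constants.\<close>

lemma uniform_or_separated_subseq:
  fixes x :: "nat \<Rightarrow> 'a"
  obtains (uniform) r C where "strict_mono r" "1 \<le> C" "\<And>k. uniform smul C k (Suc k) (x \<circ> r)"
  | (separated) r where "strict_mono r" "\<And>n. \<exists>k. separated smul (real (Suc n)) k (Suc n) (x \<circ> r)"
proof (cases "\<exists>n. \<exists>s :: nat \<Rightarrow> nat. strict_mono s \<and> (\<forall>k. \<forall>r :: nat \<Rightarrow> nat. strict_mono r \<longrightarrow>
    (\<exists>r' :: nat \<Rightarrow> nat. strict_mono r' \<and> uniform smul (real (Suc n)) k 0 (x \<circ> s \<circ> (r \<circ> r'))))")
  case True
  then obtain n and s :: "nat \<Rightarrow> nat" where s: "strict_mono s" and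
    ex: "\<And>k. \<And>r :: nat \<Rightarrow> nat. strict_mono r \<Longrightarrow> \<exists>r' :: nat \<Rightarrow> nat. strict_mono r' \<and> uniform smul (real (Suc n)) k 0 (x \<circ> s \<circ> (r \<circ> r'))"
    by blast
  interpret subseqs "\<lambda>k r. uniform smul (real (Suc n)) k 0 (x \<circ> s \<circ> r)"
    by unfold_locales (rule ex)
  \<comment> \<open>Dropping the first \<open>k + 1\<close> terms makes the diagonal sequence a
    subsequence of one that is uniform for \<open>k\<close>; this is the origin of the threshold
    \<open>Suc k\<close>.\<close>
  have "uniform smul (real (Suc n)) k 0 (x \<circ> s \<circ> (diagseq \<circ> (+) (Suc k)))" for k
    by (rule diagseq_holds) (rule uniform_subseq)
  then have "uniform smul (real (Suc n)) k 0 (x \<circ> (s \<circ> diagseq) \<circ> (+) (Suc k))" for k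
    by (simp only: comp_assoc)
  then have "uniform smul (real (Suc n)) k (Suc k) (x \<circ> (s \<circ> diagseq))" for k
    by (rule uniform_shift)
  moreover have "strict_mono (s \<circ> diagseq)"
    using s subseq_diagseq by (rule strict_mono_o)
  ultimately show ?thesis
    using uniform[of "s \<circ> diagseq" "real (Suc n)"] by simp
next
  case False
  have ex: "\<exists>r' :: nat \<Rightarrow> nat. strict_mono r' \<and> (\<exists>k. separated smul (real (Suc n)) k 0 (x \<circ> (s \<circ> r')))"
    if s: "strict_mono s" for n and s :: "nat \<Rightarrow> nat"
  proof -
    obtain k and r :: "nat \<Rightarrow> nat" where r: "strict_mono r"
      and no: "\<And>r' :: nat \<Rightarrow> nat. strict_mono r' \<Longrightarrow> \<not> uniform smul (real (Suc n)) k 0 (x \<circ> s \<circ> (r \<circ> r'))"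
      using False s by blast
    obtain r' :: "nat \<Rightarrow> nat" where r': "strict_mono r'" "uniform smul (real (Suc n)) k 0 (x \<circ> s \<circ> r \<circ> r') \<or>
        separated smul (real (Suc n)) k 0 (x \<circ> s \<circ> r \<circ> r')"
      by (rule uniform_or_separated)
    with no have "separated smul (real (Suc n)) k 0 (x \<circ> (s \<circ> (r \<circ> r')))"
      by (auto simp: comp_assoc)
    with strict_mono_o[OF r r'(1)] show ?thesis by blast
  qed
  interpret subseqs "\<lambda>n r. \<exists>k. separated smul (real (Suc n)) k 0 (x \<circ> r)"
    by unfold_locales (rule ex)
  have "\<exists>k. separated smul (real (Suc n)) k 0 (x \<circ> (diagseq \<circ> (+) (Suc n)))" for n
    by (rule diagseq_holds) (blast intro: separated_subseq)
  then have "\<exists>k. separated smul (real (Suc n)) k (Suc n) (x \<circ> diagseq)" for n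
    unfolding comp_assoc[symmetric] by (blast dest: separated_shift)
  with subseq_diagseq show ?thesis by (rule separated)
qed

text \<open>If \<open>y\<close> had tail copies for all \<open>M > m\<close>, any two copies of the
  same \<open>k\<close>-piece would be equivalent with a constant independent of \<open>k\<close>.
  Placed far out and one after the other, they contradict separation.\<close>

lemma separated_imp_gap_tight:
  assumes sep: "\<And>n. \<exists>k. separated smul (real (Suc n)) k (Suc n) x"
  shows "gap_tight smul x"
  unfolding gap_tight_def
proof (intro allI impI, rule ccontr)
  fix y m and K :: real
  assume "\<not> (\<exists>M>m. \<not> tail_copy smul x y m K M)"
  then have tc: "tail_copy smul x y m K M" if "m < M" for M
    using that by blast
  from tail_copies_ordered[OF tc] obtain h \<tau> where h: "strict_mono (h :: nat \<Rightarrow> nat)"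
    and above: "\<And>M i. i < M \<Longrightarrow> M \<le> \<tau> M i"
    and copy: "\<And>M. equiv_on smul K {..<M} (y \<circ> h) (x \<circ> \<tau> M)"
    and ord: "\<And>k :: nat. \<exists>\<rho>. bij_betw \<rho> {..<k} {..<k} \<and> (\<forall>M p. strict_mono_on {..<k} p \<longrightarrow>
        (\<forall>i<k. p i < M) \<longrightarrow> strict_mono_on {..<k} (\<tau> M \<circ> p \<circ> \<rho>))"
    by blast
  \<comment> \<open>Transitivity asks for a nonnegative constant, while \<open>K\<close> is an
    arbitrary real.\<close>
  define L where "L = max K 0"
  obtain n :: nat where n: "L * L \<le> real n"
    using real_arch_simple by blast
  obtain k where k: "separated smul (real (Suc n)) k (Suc n) x"
    using sep by blast
  obtain \<rho> where \<rho>: "bij_betw \<rho> {..<k} {..<k}"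
    and mono: "\<And>M p. strict_mono_on {..<k} p \<Longrightarrow> (\<forall>i<k. p i < M) \<Longrightarrow> strict_mono_on {..<k} (\<tau> M \<circ> p \<circ> \<rho>)"
    using ord[of k] by blast
  have \<rho>k: "\<rho> i < k" if "i < k" for i
    using \<rho> that by (auto simp: bij_betw_def)
  \<comment> \<open>\<open>M1\<close> puts the first copy past the threshold \<open>Suc n\<close>.
    The sum in \<open>M2\<close> bounds all entries of that copy, so the second copy lies wholly
    beyond the first.\<close>
  define M1 where "M1 = k + n + 1"
  define M2 where "M2 = k + Suc (\<Sum>i<k. \<tau> M1 i)"
  have M2: "\<tau> M1 i < M2" if "i < k" for i
    using member_le_sum[of i "{..<k}" "\<tau> M1"] that by (simp add: M2_def)
  have m1: "strict_mono_on {..<k} (\<tau> M1 \<circ> \<rho>)"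
    using mono[of id M1] by (simp add: M1_def strict_mono_on_def)
  have m2: "strict_mono_on {..<k} (\<tau> M2 \<circ> \<rho>)"
    using mono[of id M2] by (simp add: M2_def strict_mono_on_def)
  have "successive_tuples k (Suc n) (\<tau> M1 \<circ> \<rho>) (\<tau> M2 \<circ> \<rho>)"
    unfolding successive_tuples_def
  proof (intro conjI allI impI)
    fix i assume i: "i < k"
    show "Suc n \<le> (\<tau> M1 \<circ> \<rho>) i"
      using above[of "\<rho> i" M1] \<rho>k[OF i] by (simp add: M1_def)
    fix j assume j: "j < k"
    have "M2 \<le> \<tau> M2 (\<rho> j)"
      using \<rho>k[OF j] by (intro above) (simp add: M2_def)
    with M2[OF \<rho>k[OF i]] show "(\<tau> M1 \<circ> \<rho>) i < (\<tau> M2 \<circ> \<rho>) j" by simp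
  qed (fact m1 m2)+
  moreover have "equiv_on smul (real (Suc n)) {..<k} (x \<circ> (\<tau> M1 \<circ> \<rho>)) (x \<circ> (\<tau> M2 \<circ> \<rho>))"
  proof -
    have L: "equiv_on smul L {..<k} (y \<circ> h) (x \<circ> \<tau> M)" if "k \<le> M" for M
      using that equiv_on_mono[OF equiv_on_subset[OF copy[of M], of "{..<k}"], of L] by (simp add: L_def)
    have "equiv_on smul (L * L) {..<k} (x \<circ> \<tau> M1) (x \<circ> \<tau> M2)"
      by (rule equiv_on_trans[OF equiv_on_sym[OF L] L]) (simp_all add: M1_def M2_def L_def)
    from equiv_on_reindex[OF this, of \<rho> "{..<k}"]
    have "equiv_on smul (L * L) {..<k} (x \<circ> \<tau> M1 \<circ> \<rho>) (x \<circ> \<tau> M2 \<circ> \<rho>)"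
      using \<rho> by (auto simp: bij_betw_def)
    then show ?thesis
      using n by (auto simp: comp_assoc intro: equiv_on_mono)
  qed
  ultimately show False
    using k by (auto simp: separated_def)
qed

text \<open>On the first \<open>k\<close> terms compare \<open>y \<circ> h\<close> with
  \<open>x \<circ> \<tau> M1\<close>, then with \<open>x \<circ> \<tau> M2 \<circ> g\<close>, then
  with \<open>y \<circ> h \<circ> g\<close>: copy outwards, use uniformity, copy back. The constant
  \<open>L * C * L\<close> depends on neither \<open>k\<close> nor \<open>g\<close>.\<close>

lemma uniform_imp_spreading_or_gap_tight:
  assumes uni: "\<And>k. uniform smul C k (Suc k) x" and C: "1 \<le> C"
    and basic: "\<And>r. strict_mono r \<Longrightarrow> basic_sequence smul (x \<circ> r)"
  shows "(\<exists>r. strict_mono r \<and> spreading smul (x \<circ> r)) \<or> gap_tight smul x"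
proof (intro disjCI)
  assume "\<not> gap_tight smul x"
  then obtain y m K where "is_subsequence y x" and tc: "\<And>M. m < M \<Longrightarrow> tail_copy smul x y m K M"
    unfolding gap_tight_def by blast
  then obtain r where r: "strict_mono r" "y = x \<circ> r"
    by (auto simp: is_subsequence_def)
  from tail_copies_ordered[OF tc] obtain h \<tau> where h: "strict_mono (h :: nat \<Rightarrow> nat)"
    and above: "\<And>M i. i < M \<Longrightarrow> M \<le> \<tau> M i"
    and copy: "\<And>M. equiv_on smul K {..<M} (y \<circ> h) (x \<circ> \<tau> M)"
    and ord: "\<And>k :: nat. \<exists>\<rho>. bij_betw \<rho> {..<k} {..<k} \<and> (\<forall>M p. strict_mono_on {..<k} p \<longrightarrow>
        (\<forall>i<k. p i < M) \<longrightarrow> strict_mono_on {..<k} (\<tau> M \<circ> p \<circ> \<rho>))"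
    by blast
  define L where "L = max K 1"
  have L: "1 \<le> L" by (simp add: L_def)
  have "equiv_on smul (L * C * L) {..<k} (y \<circ> h) (y \<circ> h \<circ> g)" if g: "strict_mono g" for g and k :: nat
  proof -
    obtain \<rho> where \<rho>: "bij_betw \<rho> {..<k} {..<k}"
      and mono: "\<And>M p. strict_mono_on {..<k} p \<Longrightarrow> (\<forall>i<k. p i < M) \<Longrightarrow> strict_mono_on {..<k} (\<tau> M \<circ> p \<circ> \<rho>)"
      using ord[of k] by blast
    have \<rho>k: "\<rho> i < k" if "i < k" for i
      using \<rho> that by (auto simp: bij_betw_def)
    define M1 where "M1 = k + 1"
    \<comment> \<open>\<open>M2\<close> exceeds each \<open>g i\<close> with \<open>i < k\<close>,
      so the second copy contains the terms picked by \<open>g\<close>, and it exceeds every entry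
      of the first copy.\<close>
    define M2 where "M2 = g k + Suc (\<Sum>i<k. \<tau> M1 i)"
    have M2: "\<tau> M1 i < M2" if "i < k" for i
      using member_le_sum[of i "{..<k}" "\<tau> M1"] that by (simp add: M2_def)
    have gM: "g i < M2" if "i < k" for i
      using strict_monoD[OF g that] by (simp add: M2_def)
    have m1: "strict_mono_on {..<k} (\<tau> M1 \<circ> \<rho>)"
      using mono[of id M1] by (simp add: M1_def strict_mono_on_def)
    have m2: "strict_mono_on {..<k} (\<tau> M2 \<circ> g \<circ> \<rho>)"
      using mono[of g M2] gM g by (simp add: strict_mono_on_def strict_mono_def)
    have "successive_tuples k (Suc k) (\<tau> M1 \<circ> \<rho>) (\<tau> M2 \<circ> g \<circ> \<rho>)"
      unfolding successive_tuples_def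
    proof (intro conjI allI impI)
      fix i assume i: "i < k"
      show "Suc k \<le> (\<tau> M1 \<circ> \<rho>) i"
        using above[of "\<rho> i" M1] \<rho>k[OF i] by (simp add: M1_def)
      fix j assume j: "j < k"
      have "M2 \<le> \<tau> M2 (g (\<rho> j))"
        using \<rho>k[OF j] by (intro above gM)
      with M2[OF \<rho>k[OF i]] show "(\<tau> M1 \<circ> \<rho>) i < (\<tau> M2 \<circ> g \<circ> \<rho>) j" by simp
    qed (fact m1 m2)+
    with uni[of k] have "equiv_on smul C {..<k} (x \<circ> (\<tau> M1 \<circ> \<rho>)) (x \<circ> (\<tau> M2 \<circ> g \<circ> \<rho>))"
      unfolding uniform_def by blast
    \<comment> \<open>Uniformity compares increasing tuples only; inverting \<open>\<rho>\<close>
      returns to the order in which the terms of \<open>y\<close> are copied.\<close>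
    from equiv_on_reindex[OF this, of "the_inv_into {..<k} \<rho>" "{..<k}"]
    have "equiv_on smul C {..<k} (x \<circ> (\<tau> M1 \<circ> \<rho>) \<circ> the_inv_into {..<k} \<rho>)
        (x \<circ> (\<tau> M2 \<circ> g \<circ> \<rho>) \<circ> the_inv_into {..<k} \<rho>)"
      using bij_betw_the_inv_into[OF \<rho>] by (auto simp: bij_betw_def)
    also have "?this \<longleftrightarrow> equiv_on smul C {..<k} (x \<circ> \<tau> M1) (x \<circ> \<tau> M2 \<circ> g)"
      by (rule equiv_on_cong) (use \<rho> in \<open>auto simp: bij_betw_def f_the_inv_into_f\<close>)
    finally have mid: "equiv_on smul C {..<k} (x \<circ> \<tau> M1) (x \<circ> \<tau> M2 \<circ> g)" .
    have left: "equiv_on smul L {..<k} (y \<circ> h) (x \<circ> \<tau> M1)"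
      using equiv_on_mono[OF equiv_on_subset[OF copy[of M1], of "{..<k}"], of L] by (simp add: L_def M1_def)
    have "equiv_on smul K {..<k} (y \<circ> h \<circ> g) (x \<circ> \<tau> M2 \<circ> g)"
      by (rule equiv_on_reindex[OF copy[of M2]])
        (use gM strict_mono_imp_inj_on[OF g] in \<open>auto intro: inj_on_subset\<close>)
    then have right: "equiv_on smul L {..<k} (x \<circ> \<tau> M2 \<circ> g) (y \<circ> h \<circ> g)"
      by (rule equiv_on_sym[OF equiv_on_mono]) (simp add: L_def)
    show ?thesis
      by (rule equiv_on_trans[OF equiv_on_trans[OF left mid] right]) (use L C in auto)
  qed
  moreover have "1 * 1 * 1 \<le> L * C * L"
    using L C by (intro mult_mono) auto
  ultimately have "equivalent_seq smul (y \<circ> h) (y \<circ> h \<circ> g)" if "strict_mono g" for g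
    unfolding equivalent_seq_iff_equiv_on lessThan_Suc_atMost[symmetric]
    using that by (intro exI[of _ "L * C * L"]) simp
  moreover have "basic_sequence smul (y \<circ> h)"
    using basic[OF strict_mono_o[OF r(1) h]] by (simp add: r(2) comp_assoc)
  ultimately have "spreading smul (y \<circ> h)"
    by (auto simp: spreading_def is_subsequence_def)
  then have "spreading smul (x \<circ> (r \<circ> h))"
    by (simp add: r(2) comp_assoc)
  with strict_mono_o[OF r(1) h] show "\<exists>r. strict_mono r \<and> spreading smul (x \<circ> r)" by blast
qed

section \<open>Subsequences of basic sequences\<close>

lemma tendsto_smul:
  assumes "(f \<longlongrightarrow> l) F"
  shows "((\<lambda>x. smul c (f x)) \<longlongrightarrow> smul c l) F"
proof -
  have "((\<lambda>x. norm c * norm (f x - l)) \<longlongrightarrow> 0) F"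
    by (rule tendsto_mult_right_zero[OF tendsto_norm_zero[OF LIM_zero[OF assms]]])
  then have "((\<lambda>x. norm (smul c (f x) - smul c l)) \<longlongrightarrow> 0) F"
    by (simp only: norm_scale scale_right_diff_distrib[symmetric])
  then show ?thesis by (rule LIM_zero_cancel[OF tendsto_norm_zero_cancel])
qed

lemma sums_smul: "f sums l \<Longrightarrow> (\<lambda>n. smul c (f n)) sums smul c l"
  unfolding sums_def scale_sum_right[symmetric] by (rule tendsto_smul)

lemma sums_smul_left:
  assumes "f sums c"
  shows "(\<lambda>n. smul (f n) x) sums smul c x"
proof -
  have "(\<lambda>n. norm ((\<Sum>i<n. f i) - c) * norm x) \<longlonglongrightarrow> 0"
    by (rule tendsto_mult_left_zero[OF tendsto_norm_zero[OF LIM_zero[OF assms[unfolded sums_def]]]])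
  then have "(\<lambda>n. norm (smul (\<Sum>i<n. f i) x - smul c x)) \<longlonglongrightarrow> 0"
    by (simp only: norm_scale scale_left_diff_distrib[symmetric])
  then show ?thesis
    unfolding sums_def scale_sum_left[symmetric] by (rule LIM_zero_cancel[OF tendsto_norm_zero_cancel])
qed

text \<open>For basic \<open>e\<close> this is the closed ball of radius \<open>N\<close> of the
  norm that takes the supremum of \<open>norm\<close> over all partial sums of the
  expansion.\<close>

definition bounded_expansions :: "(nat \<Rightarrow> 'a) \<Rightarrow> real \<Rightarrow> 'a set" where
  "bounded_expansions e N =
     {v. \<exists>a. (\<lambda>n. smul (a n) (e n)) sums v \<and> (\<forall>n. norm (\<Sum>i<n. smul (a i) (e i)) \<le> N)}"

lemma bounded_expansionsI:
  assumes "(\<lambda>n. smul (a n) (e n)) sums v" "\<And>n. norm (\<Sum>i<n. smul (a i) (e i)) \<le> N"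
  shows "v \<in> bounded_expansions e N"
  using assms unfolding bounded_expansions_def by blast

lemma sums_in_closure_span:
  assumes "(\<lambda>n. smul (a n) (e n)) sums v"
  shows "v \<in> closure (span (range e))"
proof -
  have "(\<Sum>i<n. smul (a i) (e i)) \<in> span (range e)" for n
    by (intro span_sum span_scale span_base) simp
  with assms show ?thesis
    unfolding closure_sequential sums_def by (intro exI[of _ "\<lambda>n. \<Sum>i<n. smul (a i) (e i)"]) simp
qed

lemma basic_sequence_unique:
  assumes "basic_sequence smul e" "(\<lambda>n. smul (a n) (e n)) sums v" "(\<lambda>n. smul (b n) (e n)) sums v"
  shows "a = b"
  using assms sums_in_closure_span[OF assms(2)] unfolding basic_sequence_def by blast

lemma basic_sequence_nonzero:
  assumes "basic_sequence smul e"
  shows "e i \<noteq> 0"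
proof
  assume "e i = 0"
  define d :: "nat \<Rightarrow> 'k" where "d n = (if n = i then 1 else 0)" for n
  have "(\<lambda>n. smul (d n) (e n)) = (\<lambda>_. 0)"
    using \<open>e i = 0\<close> by (auto simp: d_def)
  then have "(\<lambda>n. smul (d n) (e n)) sums 0" by simp
  moreover have "(\<lambda>n. smul 0 (e n)) sums 0" by simp
  ultimately have "d = (\<lambda>_. 0)"
    by (rule basic_sequence_unique[OF assms])
  from fun_cong[OF this, of i] show False
    by (simp add: d_def)
qed

lemma bounded_expansions_diff:
  assumes "u \<in> bounded_expansions e N" "v \<in> bounded_expansions e M"
  shows "u - v \<in> bounded_expansions e (N + M)"
proof -
  obtain a b where a: "(\<lambda>n. smul (a n) (e n)) sums u" "\<And>n. norm (\<Sum>i<n. smul (a i) (e i)) \<le> N"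
    and b: "(\<lambda>n. smul (b n) (e n)) sums v" "\<And>n. norm (\<Sum>i<n. smul (b i) (e i)) \<le> M"
    using assms by (auto simp: bounded_expansions_def)
  have "(\<lambda>n. smul (a n - b n) (e n)) sums (u - v)"
    unfolding scale_left_diff_distrib using a(1) b(1) by (rule sums_diff)
  moreover have "norm (\<Sum>i<n. smul (a i - b i) (e i)) \<le> N + M" for n
    unfolding scale_left_diff_distrib sum_subtractf
    by (rule order_trans[OF norm_triangle_ineq4 add_mono[OF a(2) b(2)]])
  ultimately show ?thesis
    by (rule bounded_expansionsI)
qed

lemma bounded_expansions_smul:
  assumes "u \<in> bounded_expansions e N"
  shows "smul c u \<in> bounded_expansions e (norm c * N)"
proof -
  obtain a where a: "(\<lambda>n. smul (a n) (e n)) sums u" "\<And>n. norm (\<Sum>i<n. smul (a i) (e i)) \<le> N"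
    using assms by (auto simp: bounded_expansions_def)
  have "(\<lambda>n. smul (c * a n) (e n)) sums smul c u"
    using sums_smul[OF a(1), of c] by simp
  moreover have "norm (\<Sum>i<n. smul (c * a i) (e i)) \<le> norm c * N" for n
    unfolding scale_scale[symmetric] scale_sum_right[symmetric] norm_scale
    by (intro mult_left_mono a(2)) simp
  ultimately show ?thesis
    by (rule bounded_expansionsI)
qed

text \<open>Each coefficient is a difference of consecutive partial sums divided by
  \<open>e i\<close>, so the coefficients of the \<open>v j\<close> are summable in
  \<open>j\<close>. Their sums \<open>b\<close> are the coefficients of \<open>w\<close>.\<close>

lemma bounded_expansions_suminf:
  assumes e: "\<And>i. e i \<noteq> 0" and v: "\<And>j. v j \<in> bounded_expansions e (N j)"
    and N: "summable N" and sums: "v sums w"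
  shows "w \<in> bounded_expansions e (suminf N)"
proof -
  obtain a where a: "\<And>j. (\<lambda>n. smul (a j n) (e n)) sums v j"
    and aN: "\<And>j n. norm (\<Sum>i<n. smul (a j i) (e i)) \<le> N j"
    using v unfolding bounded_expansions_def mem_Collect_eq by metis
  have "summable (\<lambda>j. a j i)" for i
  proof (rule summable_comparison_test)
    have "norm (a j i) \<le> 2 / norm (e i) * N j" for j
    proof -
      have "smul (a j i) (e i) = (\<Sum>i<Suc i. smul (a j i) (e i)) - (\<Sum>i<i. smul (a j i) (e i))"
        by simp
      also have "norm \<dots> \<le> N j + N j"
        by (rule order_trans[OF norm_triangle_ineq4 add_mono[OF aN aN]])
      finally show ?thesis
        using e[of i] by (simp add: norm_scale field_simps)
    qed
    then show "\<exists>M. \<forall>j\<ge>M. norm (a j i) \<le> 2 / norm (e i) * N j" by blast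
    show "summable (\<lambda>j. 2 / norm (e i) * N j)"
      using N by (rule summable_mult)
  qed
  define b where "b i = (\<Sum>j. a j i)" for i
  have "(\<lambda>j. a j i) sums b i" for i
    unfolding b_def using \<open>\<And>i. summable (\<lambda>j. a j i)\<close> by (rule summable_sums)
  then have part: "(\<lambda>j. \<Sum>i<n. smul (a j i) (e i)) sums (\<Sum>i<n. smul (b i) (e i))" for n
    by (intro sums_sum sums_smul_left)
  \<comment> \<open>The majorant \<open>N j\<close> does not depend on \<open>n\<close>, which
    permits exchanging the limit in \<open>n\<close> with the sum over \<open>j\<close>.\<close>
  have unif: "uniform_limit UNIV (\<lambda>J n. \<Sum>j<J. \<Sum>i<n. smul (a j i) (e i))
      (\<lambda>n. \<Sum>j. \<Sum>i<n. smul (a j i) (e i)) sequentially"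
    by (rule Weierstrass_m_test[OF _ N]) (rule aN)
  have "(\<lambda>n. \<Sum>j. \<Sum>i<n. smul (a j i) (e i)) \<longlonglongrightarrow> w"
  proof (rule swap_uniform_limit'[OF _ _ unif])
    show "\<forall>\<^sub>F J in sequentially. (\<lambda>n. \<Sum>j<J. \<Sum>i<n. smul (a j i) (e i)) \<longlonglongrightarrow> (\<Sum>j<J. v j)"
      using a by (intro always_eventually allI tendsto_sum) (simp add: sums_def)
    show "(\<lambda>J. \<Sum>j<J. v j) \<longlonglongrightarrow> w"
      using sums by (simp add: sums_def)
  qed auto
  then have "(\<lambda>n. smul (b n) (e n)) sums w"
    by (simp add: sums_def sums_unique[OF part, symmetric])
  moreover have "norm (\<Sum>i<n. smul (b i) (e i)) \<le> suminf N" for n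
    using norm_suminf_le[OF aN N] sums_unique[OF part] by simp
  ultimately show ?thesis
    by (rule bounded_expansionsI)
qed

text \<open>This is Zabreiko's lemma for the seminorm \<open>v \<mapsto> sup\<^sub>n \<parallel>P\<^sub>n v\<parallel>\<close>, where \<open>P\<^sub>n\<close> are the partial sum projections.\<close>

lemma basic_sequence_bounded_near_0:
  assumes e: "basic_sequence smul e"
  obtains \<epsilon> N where "0 < \<epsilon>"
    "\<And>u. u \<in> closure (span (range e)) \<Longrightarrow> norm u < \<epsilon> \<Longrightarrow> u \<in> bounded_expansions e N"
proof -
  let ?X = "closure (span (range e))" and ?B = "bounded_expansions e"
  have B_sub: "?B N \<subseteq> ?X" for N
    by (auto simp: bounded_expansions_def dest: sums_in_closure_span)
  have ex: "\<exists>n. v \<in> ?B (real n)" if v: "v \<in> ?X" for v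
  proof -
    obtain a where a: "(\<lambda>n. smul (a n) (e n)) sums v"
      using e v unfolding basic_sequence_def by blast
    then have "Bseq (\<lambda>n. \<Sum>i<n. smul (a i) (e i))"
      unfolding sums_def by (rule convergent_imp_Bseq[OF convergentI])
    then obtain K where K: "\<And>n. norm (\<Sum>i<n. smul (a i) (e i)) \<le> K"
      unfolding Bseq_def by blast
    obtain n :: nat where "K \<le> real n"
      using real_arch_simple by blast
    then have "v \<in> ?B (real n)"
      by (intro bounded_expansionsI[OF a] order_trans[OF K])
    then show ?thesis ..
  qed
  have X_diff: "u - v \<in> ?X" if "u \<in> ?X" "v \<in> ?X" for u v
    using ex[OF that(1)] ex[OF that(2)] bounded_expansions_diff[of u e _ v] B_sub by blast
  have X_smul: "smul c u \<in> ?X" if "u \<in> ?X" for c u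
    using ex[OF that] bounded_expansions_smul[of u e _ c] B_sub by blast
  have "0 \<in> ?X"
    using span_zero closure_subset by blast
  \<comment> \<open>By \<open>ex\<close> the closures of the sets \<open>?B (real n)\<close> cover
    the complete space \<open>?X\<close>, so by Baire one of them has interior points.\<close>
  obtain n where n: "top_of_set ?X interior_of closure (?B (real n)) \<noteq> {}"
  proof (rule ccontr)
    assume "\<not> thesis"
    with that have no: "top_of_set ?X interior_of closure (?B (real n)) = {}" for n
      by blast
    have cl: "closure (?B (real n)) \<subseteq> ?X" for n
      using B_sub by (simp add: closure_minimal)
    have "top_of_set ?X interior_of \<Union>(range (\<lambda>n. closure (?B (real n)))) = {}"
    proof (rule Baire_category_alt)
      show "completely_metrizable_space (top_of_set ?X) \<or>
          locally_compact_space (top_of_set ?X) \<and> regular_space (top_of_set ?X)"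
        by (rule disjI1[OF completely_metrizable_space_closedin[OF completely_metrizable_space_euclidean]]) simp
      show "closedin (top_of_set ?X) T \<and> top_of_set ?X interior_of T = {}"
        if "T \<in> range (\<lambda>n. closure (?B (real n)))" for T
        using that no cl by (auto intro!: closed_subset)
    qed simp
    moreover have "?X \<subseteq> \<Union>(range (\<lambda>n. closure (?B (real n))))"
    proof
      fix v assume "v \<in> ?X"
      then obtain n where "v \<in> ?B (real n)" using ex by blast
      with closure_subset[of "?B (real n)"] show "v \<in> \<Union>(range (\<lambda>n. closure (?B (real n))))"
        by blast
    qed
    then have "\<Union>(range (\<lambda>n. closure (?B (real n)))) = ?X"
      using cl by blast
    ultimately have "top_of_set ?X interior_of ?X = {}" by simp
    then show False
      using \<open>0 \<in> ?X\<close> interior_of_topspace[of "top_of_set ?X"] by auto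
  qed
  then obtain v0 U where U: "openin (top_of_set ?X) U" "v0 \<in> U" "U \<subseteq> closure (?B (real n))"
    unfolding interior_of_def by blast
  then obtain \<epsilon> where \<epsilon>: "0 < \<epsilon>" "ball v0 \<epsilon> \<inter> ?X \<subseteq> U"
    using openin_contains_ball by metis
  define D where "D = real n + real n"
  have v0: "v0 \<in> ?X"
    using U(1,2) openin_imp_subset by blast
  \<comment> \<open>Subtracting approximations of \<open>v0\<close> from those of
    \<open>v0 + u\<close> moves the ball to the origin, at the price of doubling the bound.\<close>
  have near: "u \<in> closure (?B D)" if u: "u \<in> ?X" "norm u < \<epsilon>" for u
  proof -
    have "v0 + u \<in> ?X"
      using X_diff[OF v0 X_diff[OF \<open>0 \<in> ?X\<close> u(1)]] by simp
    moreover have "v0 + u \<in> ball v0 \<epsilon>"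
      using u(2) by (simp add: dist_norm)
    ultimately have "v0 + u \<in> closure (?B (real n))" "v0 \<in> closure (?B (real n))"
      using \<epsilon>(2) U(2,3) by blast+
    then obtain x y where x: "\<And>k. x k \<in> ?B (real n)" "x \<longlonglongrightarrow> v0 + u"
      and y: "\<And>k. y k \<in> ?B (real n)" "y \<longlonglongrightarrow> v0"
      unfolding closure_sequential by blast
    have "(\<lambda>k. x k - y k) \<longlonglongrightarrow> u"
      using tendsto_diff[OF x(2) y(2)] by simp
    with bounded_expansions_diff[OF x(1) y(1)] show ?thesis
      unfolding closure_sequential D_def by (intro exI[of _ "\<lambda>k. x k - y k"]) simp
  qed
  \<comment> \<open>\<open>u'\<close> is the remainder after approximating \<open>u\<close> by means
    of \<open>near\<close>, rescaled by \<open>2 ^ j\<close>.\<close>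
  have step: "\<exists>u'\<in>?X. norm u' < \<epsilon> / 2 ^ Suc j \<and> u - u' \<in> ?B (D / 2 ^ j)"
    if u: "u \<in> ?X" "norm u < \<epsilon> / 2 ^ j" for u j
  proof -
    have two: "norm (2 ^ j :: 'k) = 2 ^ j"
      by (simp add: norm_power)
    then have inv: "norm (inverse (2 ^ j) :: 'k) = 1 / 2 ^ j"
      by (simp only: norm_inverse divide_inverse mult_1)
    have "smul (2 ^ j) u \<in> closure (?B D)"
      using u by (intro near X_smul) (simp_all add: norm_scale two field_simps)
    then obtain w where w: "w \<in> ?B D" "dist w (smul (2 ^ j) u) < \<epsilon> / 2"
      unfolding closure_approachable using \<epsilon>(1) by (meson half_gt_zero)
    define w' where "w' = smul (inverse (2 ^ j)) w"
    have w': "w' \<in> ?B (D / 2 ^ j)"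
      using bounded_expansions_smul[OF w(1), of "inverse (2 ^ j)"] unfolding w'_def inv by simp
    have "u - w' = smul (inverse (2 ^ j)) (smul (2 ^ j) u - w)"
      by (simp add: w'_def scale_right_diff_distrib)
    then have "norm (u - w') = norm (smul (2 ^ j) u - w) / 2 ^ j"
      by (simp only: norm_scale inv) simp
    also have "\<dots> < \<epsilon> / 2 / 2 ^ j"
      using w(2) by (intro divide_strict_right_mono) (simp_all add: dist_norm norm_minus_commute)
    finally have "norm (u - w') < \<epsilon> / 2 ^ Suc j" by simp
    moreover have "u - w' \<in> ?X"
      using u(1) w' B_sub X_diff by blast
    ultimately show ?thesis
      using w' by (intro bexI[of _ "u - w'"]) simp_all
  qed
  \<comment> \<open>Iterating \<open>step\<close> gives remainders \<open>f j\<close> tending to 0.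
    Then \<open>u\<close> is the telescoping sum of their differences, whose bounds form a geometric
    series; this removes the closure from \<open>near\<close>.\<close>
  have "u \<in> ?B (\<Sum>j. D / 2 ^ j)" if u: "u \<in> ?X" "norm u < \<epsilon>" for u
  proof -
    have "\<exists>f. \<forall>j. (f j \<in> ?X \<and> norm (f j) < \<epsilon> / 2 ^ j \<and> (j = 0 \<longrightarrow> f j = u)) \<and>
        f j - f (Suc j) \<in> ?B (D / 2 ^ j)"
      by (rule dependent_nat_choice) (use u step in auto)
    then obtain f where f: "\<And>j. norm (f j) < \<epsilon> / 2 ^ j" "f 0 = u"
      "\<And>j. f j - f (Suc j) \<in> ?B (D / 2 ^ j)"
      by blast
    have "(\<lambda>j. \<epsilon> / 2 ^ j) \<longlonglongrightarrow> 0"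
      by (rule LIMSEQ_divide_realpow_zero) simp
    then have "f \<longlonglongrightarrow> 0"
      by (rule Lim_null_comparison[rotated]) (use f(1) less_imp_le in \<open>auto intro: always_eventually\<close>)
    from telescope_sums'[OF this] have "(\<lambda>j. f j - f (Suc j)) sums u"
      by (simp add: f(2))
    moreover have "summable (\<lambda>j. D / 2 ^ j)"
      using summable_mult[OF summable_geometric[of "1 / 2 :: real"], of D] by (simp add: power_divide)
    ultimately show ?thesis
      by (intro bounded_expansions_suminf[OF basic_sequence_nonzero[OF e] f(3)])
  qed
  with \<epsilon>(1) show ?thesis by (rule that)
qed

text \<open>Homogeneity turns the bound near 0 into a linear one, and uniqueness identifies the
  expansion known to be bounded with the given one.\<close>

lemma basic_sequence_basis_constant:
  assumes e: "basic_sequence smul e"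
  obtains C where "\<And>a v n. (\<lambda>n. smul (a n) (e n)) sums v \<Longrightarrow> norm (\<Sum>i<n. smul (a i) (e i)) \<le> C * norm v"
proof -
  obtain \<epsilon> N where \<epsilon>: "0 < \<epsilon>"
    and near: "\<And>u. u \<in> closure (span (range e)) \<Longrightarrow> norm u < \<epsilon> \<Longrightarrow> u \<in> bounded_expansions e N"
    by (rule basic_sequence_bounded_near_0[OF e]) blast
  have "norm (\<Sum>i<n. smul (a i) (e i)) \<le> 2 * N / \<epsilon> * norm v"
    if a: "(\<lambda>n. smul (a n) (e n)) sums v" for a v n
  proof (cases "v = 0")
    case True
    then have "a = (\<lambda>_. 0)"
      using basic_sequence_unique[OF e a] by simp
    then show ?thesis by (simp add: True)
  next
    case False
    \<comment> \<open>Scaling by \<open>t\<close> gives \<open>v\<close> the norm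
      \<open>\<epsilon> / 2\<close>.\<close>
    define t where "t = \<epsilon> / (2 * norm v)"
    have t: "0 < t" "t * norm v < \<epsilon>"
      using \<epsilon> False by (auto simp: t_def)
    have ta: "(\<lambda>n. smul (of_real t * a n) (e n)) sums smul (of_real t) v"
      using sums_smul[OF a, of "of_real t"] by simp
    have "smul (of_real t) v \<in> bounded_expansions e N"
      using sums_in_closure_span[OF ta] t by (intro near) (auto simp: norm_scale)
    then obtain b where b: "(\<lambda>n. smul (b n) (e n)) sums smul (of_real t) v"
      "\<And>n. norm (\<Sum>i<n. smul (b i) (e i)) \<le> N"
      by (auto simp: bounded_expansions_def)
    have "b = (\<lambda>n. of_real t * a n)"
      by (rule basic_sequence_unique[OF e b(1) ta])
    with b(2)[of n] have "norm (smul (of_real t) (\<Sum>i<n. smul (a i) (e i))) \<le> N"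
      by (simp add: scale_sum_right)
    then have "t * norm (\<Sum>i<n. smul (a i) (e i)) \<le> N"
      using t(1) by (simp add: norm_scale)
    then show ?thesis
      using \<epsilon> False by (simp add: t_def field_simps)
  qed
  then show ?thesis by (rule that)
qed

lemma span_subset_sums:
  assumes "u \<in> span (e ` J)"
  obtains b where "(\<lambda>n. smul (b n) (e n)) sums u" "\<And>n. n \<notin> J \<Longrightarrow> b n = 0"
proof -
  have "\<exists>b. (\<lambda>n. smul (b n) (e n)) sums u \<and> (\<forall>n. n \<notin> J \<longrightarrow> b n = 0)"
    using assms
  proof (induction rule: span_induct_alt)
    case base
    show ?case by (intro exI[of _ "\<lambda>_. 0"]) simp
  next
    case (step c x y)
    obtain j b where j: "j \<in> J" "x = e j"
      and b: "(\<lambda>n. smul (b n) (e n)) sums y" "\<forall>n. n \<notin> J \<longrightarrow> b n = 0"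
      using step by auto
    have "(\<lambda>n. smul (if n = j then c else 0) (e n)) = (\<lambda>n. if n = j then smul c (e n) else 0)"
      by auto
    then have "(\<lambda>n. smul (if n = j then c else 0) (e n)) sums smul c x"
      using sums_single[of j "\<lambda>n. smul c (e n)"] by (simp add: j)
    from sums_add[OF this b(1)]
    have "(\<lambda>n. smul ((if n = j then c else 0) + b n) (e n)) sums (smul c x + y)"
      by (simp add: scale_left_distrib)
    with b(2) j(1) show ?case
      by (intro exI[of _ "\<lambda>n. (if n = j then c else 0) + b n"]) auto
  qed
  with that show ?thesis by blast
qed

text \<open>\<open>spreading\<close> includes basicness, so an extracted subsequence has to inherit
  it. For existence, the \<open>e\<close>-coefficients of \<open>v\<close> off the range of
  \<open>r\<close> vanish, since by the basis constant coefficients depend continuously on the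
  vector.\<close>

lemma basic_sequence_subseq:
  assumes e: "basic_sequence smul e" and r: "strict_mono r"
  shows "basic_sequence smul (e \<circ> r)"
  unfolding basic_sequence_def
proof (intro ballI ex_ex1I)
  fix v assume v: "v \<in> closure (span (range (e \<circ> r)))"
  have sub: "closure (span (range (e \<circ> r))) \<subseteq> closure (span (range e))"
    by (intro closure_mono span_mono) auto
  obtain a where a: "(\<lambda>n. smul (a n) (e n)) sums v"
    using e v sub unfolding basic_sequence_def by blast
  obtain C where C: "\<And>a v n. (\<lambda>n. smul (a n) (e n)) sums v \<Longrightarrow>
      norm (\<Sum>i<n. smul (a i) (e i)) \<le> C * norm v"
    using basic_sequence_basis_constant[OF e] by blast
  have "smul (a i) (e i) = 0" if i: "i \<notin> range r" for i
  proof -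
    obtain w where w: "\<And>k. w k \<in> span (e ` range r)" "w \<longlonglongrightarrow> v"
      using v unfolding closure_sequential image_comp by blast
    \<comment> \<open>The approximant \<open>w k\<close> has coefficient 0 at \<open>i\<close>, so
      \<open>v\<close> and \<open>v - w k\<close> have the same coefficient there.\<close>
    have "norm (smul (a i) (e i)) \<le> 2 * C * norm (v - w k)" for k
    proof -
      obtain b where b: "(\<lambda>n. smul (b n) (e n)) sums w k" "\<And>n. n \<notin> range r \<Longrightarrow> b n = 0"
        using span_subset_sums[OF w(1)] by blast
      have d: "(\<lambda>n. smul (a n - b n) (e n)) sums (v - w k)"
        using sums_diff[OF a b(1)] by (simp add: scale_left_diff_distrib)
      have "smul (a i) (e i) =
          (\<Sum>n<Suc i. smul (a n - b n) (e n)) - (\<Sum>n<i. smul (a n - b n) (e n))"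
        by (simp add: b(2)[OF i])
      also have "norm \<dots> \<le> C * norm (v - w k) + C * norm (v - w k)"
        by (rule order_trans[OF norm_triangle_ineq4 add_mono[OF C[OF d] C[OF d]]])
      finally show ?thesis by simp
    qed
    moreover have "(\<lambda>k. 2 * C * norm (v - w k)) \<longlonglongrightarrow> 2 * C * norm (v - v)"
      by (intro tendsto_intros w(2))
    ultimately have "norm (smul (a i) (e i)) \<le> 0"
      using LIMSEQ_le_const by fastforce
    then show ?thesis by simp
  qed
  then have "(\<lambda>n. smul (a (r n)) (e (r n))) sums v"
    using sums_mono_reindex[OF r, of "\<lambda>n. smul (a n) (e n)"] a by simp
  then show "\<exists>b. (\<lambda>n. smul (b n) ((e \<circ> r) n)) sums v"
    by auto
next
  fix v b c
  assume b: "(\<lambda>n. smul (b n) ((e \<circ> r) n)) sums v" and c: "(\<lambda>n. smul (c n) ((e \<circ> r) n)) sums v"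
  \<comment> \<open>Extension by zero carries both expansions over to \<open>e\<close>, where
    uniqueness is known.\<close>
  define ext where "ext b n = (if n \<in> range r then b (inv r n) else (0 :: 'k))" for b n
  have inj: "inj r"
    by (rule strict_mono_imp_inj_on[OF r])
  have ext: "ext b (r n) = b n" for b n
    by (simp add: ext_def inv_f_f[OF inj])
  have "(\<lambda>n. smul (ext b n) (e n)) sums v" if "(\<lambda>n. smul (b n) ((e \<circ> r) n)) sums v" for b
    using sums_mono_reindex[OF r, of "\<lambda>n. smul (ext b n) (e n)"] that by (simp add: ext) (simp add: ext_def)
  from basic_sequence_unique[OF e this[OF b] this[OF c]] show "b = c"
    by (metis ext HOL.ext)
qed

end

theorem corollary10p5:
  fixes smul :: "'k::{real_normed_field,banach} \<Rightarrow> 'a::banach \<Rightarrow> 'a"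
    and e :: "nat \<Rightarrow> 'a"
  assumes "banach_space_over smul"
    and "basic_sequence smul e"
  shows "\<exists>x. is_subsequence x e \<and>
    ((\<forall>y. is_subsequence y x \<longrightarrow>
        (\<exists>I. successive_intervals I \<and>
          (\<forall>A :: nat set. infinite A \<longrightarrow>
            \<not> (\<exists>z. is_subsequence_in (UNIV - (\<Union>i\<in>A. I i)) z x \<and>
                  permutatively_equivalent smul y z))))
     \<or> spreading smul x)"
proof -
  interpret banach_space_over smul by (rule assms(1))
  have tight: ?thesis if "strict_mono r" "gap_tight smul (e \<circ> r)" for r
    using that gap_tight_imp_intervals[of "e \<circ> r"]
    by (intro exI[of _ "e \<circ> r"] conjI disjI1 allI impI) (auto simp: is_subsequence_def)
  show ?thesis
  proof (cases rule: uniform_or_separated_subseq[of e])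
    case (separated r)
    then show ?thesis
      by (intro tight separated_imp_gap_tight)
  next
    case (uniform r C)
    have "basic_sequence smul (e \<circ> r \<circ> s)" if "strict_mono s" for s
      unfolding comp_assoc using assms(2) strict_mono_o[OF uniform(1) that]
      by (rule basic_sequence_subseq)
    \<comment> \<open>In the uniform case either a further subsequence is spreading or
      \<open>e \<circ> r\<close> itself satisfies (i).\<close>
    with uniform consider s where "strict_mono s" "spreading smul (e \<circ> r \<circ> s)"
      | "gap_tight smul (e \<circ> r)"
      using uniform_imp_spreading_or_gap_tight by blast
    then show ?thesis
    proof cases
      case 1
      then show ?thesis
        using strict_mono_o[OF uniform(1) 1(1)]
        by (intro exI[of _ "e \<circ> r \<circ> s"]) (auto simp: is_subsequence_def comp_assoc)
    next
      case 2
      with uniform(1) show ?thesis by (rule tight)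
    qed
  qed
qed

end
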